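(* Assume that the Bernoulli space $(\Sigma,\mathscr{A},\mu)$ is symmetric, i.e. $\theta_n=\frac12$ for all $n\ge0$. Then every $\Phi\in \mathcal{S}^*$ is integrable with respect to the canonical spectral measure $\pi_0$.
   Context: $\mathbb{N}=\{0,1,2,\dots\}$ and $\Gamma$ is the set of all finite subsets of $\mathbb{N}$. Bernoulli space: $\Sigma=\{-1,1\}^{\mathbb{N}}$, $\zeta_n(\omega)=\omega(n)$ for $\omega\in\Sigma$, $\mathscr{A}$ is the $\sigma$-field generated by $(\zeta_n)_{n\ge 0}$, and $\mu$ is the unique probability measure on $\mathscr{A}$ under which the $\zeta_n$ are independent with $\mu(\zeta_n=1)=\theta_n$, $\mu(\zeta_n=-1)=1-\theta_n$, where $0<\theta_n<1$. In the symmetric case $\theta_n=\frac12$ for all $n$, put $Z_n=\zeta_n$, $Z_\emptyset=1$ and $Z_\sigma=\prod_{i\in\sigma}Z_i$ for nonempty $\sigma\in\Gamma$. $\mathcal{L}^2=\mathcal{L}^2(\Sigma,\mathscr{A},\mu)$ is the complex Hilbert space with inner product $\langle\xi,\eta\rangle=\int_\Sigma\overline{\xi}\eta\,d\mu$; $\{Z_\sigma\mid\sigma\in\Gamma\}$ is an orthonormal basis of $\mathcal{L}^2$. Define $\lambda_\emptyset=1$ and $\lambda_\sigma=\prod_{k\in\sigma}(1+k)$ for nonempty $\sigma\in\Gamma$. For real $p\ge0$, $\mathcal{S}_p=\{\xi\in\mathcal{L}^2\mid \sum_{\sigma\in\Gamma}\lambda_\sigma^{2p}|\langle Z_\sigma,\xi\rangle|^2<\infty\}$,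 a Hilbert space with norm $\|\xi\|_p=\big(\sum_{\sigma\in\Gamma}\lambda_\sigma^{2p}|\langle Z_\sigma,\xi\rangle|^2\big)^{1/2}$. $\mathcal{S}=\bigcap_{p\ge0}\mathcal{S}_p$ carries the topology generated by the norms $\|\cdot\|_p$, $p\ge0$ (each $Z_\sigma\in\mathcal{S}$). $\mathcal{S}^*$ is the dual of $\mathcal{S}$ (continuous linear functionals), with bilinear pairing $\langle\!\langle\Phi,\xi\rangle\!\rangle=\Phi(\xi)$ on $\mathcal{S}^*\times\mathcal{S}$. $\mathfrak{P}(\mathcal{L}^2)$ is the set of orthogonal projection operators on $\mathcal{L}^2$. A mapping $\pi\colon\mathscr{A}\to\mathfrak{P}(\mathcal{L}^2)$ is a spectral measure on $(\Sigma,\mathscr{A},\mu)$ if $\pi(\Sigma)=I$ and $\pi(\bigcup_{n\ge1}E_n)=\sum_{n\ge1}\pi(E_n)$, with convergence in the strong operator topology, for every sequence $(E_n)_{n\ge1}\subset\mathscr{A}$ of pairwise disjoint sets. It is $\mathcal{S}$-smooth if for each $(\sigma,\tau)\in\Gamma\times\Gamma$ there exists $\phi_{\sigma,\tau}^{\pi}\in\mathcal{S}$ (the numerical spectral density of $\pi$ associated with $(\sigma,\tau)$) such that $\langle\pi(E)Z_\sigma,Z_\tau\rangle=\int_E\phi_{\sigma,\tau}^{\pi}\,d\mu$ for all $E\in\mathscr{A}$. For an $\mathcal{S}$-smooth spectral measure $\pi$, $\Phi\in\mathcal{S}^*$ is integrable with respect to $\pi$ if there exist constants $C\ge0$, $p\ge0$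 such that $|\langle\!\langle\Phi,\phi_{\sigma,\tau}^{\pi}\rangle\!\rangle|\le C\lambda_\sigma^p\lambda_\tau^p$ for all $(\sigma,\tau)\in\Gamma\times\Gamma$. The canonical spectral measure $\pi_0$ on $(\Sigma,\mathscr{A},\mu)$ is given by $\pi_0(E)\xi=\mathbf{1}_E\xi$ (pointwise product with the indicator of $E$), $E\in\mathscr{A}$, $\xi\in\mathcal{L}^2$. In the symmetric case it is $\mathcal{S}$-smooth with numerical spectral densities $\phi_{\sigma,\tau}^{\pi_0}=Z_{\sigma\bigtriangleup\tau}$, where $\sigma\bigtriangleup\tau=(\sigma\setminus\tau)\cup(\tau\setminus\sigma)$. *)

theory Defs
  imports "HOL-Probability.Probability"
begin

section \<open>Bernoulli space\<close>

definition sign_seqs :: "(nat \<Rightarrow> real) set" where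
  "sign_seqs = {\<omega>. \<forall>n. \<omega> n \<in> {-1, 1}}"

definition zeta :: "nat \<Rightarrow> (nat \<Rightarrow> real) \<Rightarrow> real" where
  "zeta n \<omega> = \<omega> n"

locale bernoulli_space = prob_space M
  for M :: "(nat \<Rightarrow> real) measure" and \<theta> :: "nat \<Rightarrow> real" +
  assumes theta_bounds: "0 < \<theta> n" "\<theta> n < 1"
    and space_M: "space M = sign_seqs"
    and sets_M: "sets M =
      sigma_sets sign_seqs {zeta n -` B \<inter> sign_seqs |n B. B \<in> sets borel}"
    and indep_zeta: "indep_vars (\<lambda>_. borel) zeta UNIV"
    and prob_zeta_pos: "prob {\<omega> \<in> space M. zeta n \<omega> = 1} = \<theta> n"
    and prob_zeta_neg: "prob {\<omega> \<in> space M. zeta n \<omega> = -1} = 1 - \<theta> n"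

text \<open>For every admissible parameter sequence such a space exists, namely the product measure.\<close>

lemma bernoulli_space_exists:
  fixes \<theta> :: "nat \<Rightarrow> real"
  assumes \<theta>: "\<And>n. 0 < \<theta> n" "\<And>n. \<theta> n < 1"
  shows "\<exists>M. bernoulli_space M \<theta>"
proof -
  define K :: "nat \<Rightarrow> real measure" where
    "K n = distr (measure_pmf (bernoulli_pmf (\<theta> n))) (count_space {-1, 1})
             (\<lambda>b. if b then 1 else -1)" for n
  define M where "M = PiM UNIV K"
  have K_meas: "(\<lambda>b. if b then 1 else -1)
      \<in> measurable (measure_pmf (bernoulli_pmf (\<theta> n))) (count_space {-1, 1::real})" for n
    by auto
  have K_space: "space (K n) = {-1, 1}" and K_sets: "sets (K n) = Pow {-1, 1}" for n
    by (auto simp: K_def)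
  have K_prob: "prob_space (K n)" for n
    unfolding K_def by (rule prob_space.prob_space_distr[OF _ K_meas]) (rule prob_space_measure_pmf)
  interpret M: prob_space M
    unfolding M_def by (rule prob_space_PiM) (rule K_prob)
  have space_M: "space M = sign_seqs"
    by (auto simp: M_def space_PiM K_space sign_seqs_def PiE_def Pi_def)
  have vim: "{f \<in> \<Pi>\<^sub>E i\<in>UNIV. space (K i). f n \<in> A} = zeta n -` A \<inter> sign_seqs" for n A
    using space_M by (auto simp: M_def space_PiM zeta_def)
  have sets_M: "sets M = sigma_sets sign_seqs {zeta n -` B \<inter> sign_seqs |n B. B \<in> sets borel}"
  proof -
    have "sets M = sigma_sets sign_seqs {zeta n -` A \<inter> sign_seqs |n A. A \<in> Pow {-1, 1}}"
      unfolding M_def sets_PiM_single vim using space_M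
      by (simp add: M_def space_PiM K_sets)
    also have "{zeta n -` A \<inter> sign_seqs |n A. A \<in> Pow {-1, 1}} =
        {zeta n -` B \<inter> sign_seqs |n B. B \<in> sets borel}"
    proof (safe, goal_cases)
      case (1 _ n A)
      then have "finite A" by (meson finite.emptyI finite.insertI finite_subset)
      then have "A \<in> sets borel" by (simp add: finite_imp_closed borel_closed)
      then show ?case by blast
    next
      case (2 _ n B)
      have "zeta n -` B \<inter> sign_seqs = zeta n -` (B \<inter> {-1, 1}) \<inter> sign_seqs"
        by (auto simp: sign_seqs_def zeta_def)
      then show ?case by blast
    qed
    finally show ?thesis .
  qed
  have distr: "distr M (K n) (zeta n) = K n" for n
    unfolding M_def zeta_def[abs_def] by (rule distr_PiM_component) (auto simp: K_prob)
  have zeta_K: "zeta n \<in> measurable M (K n)" for n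
    unfolding M_def zeta_def[abs_def] by measurable
  have id_K: "(\<lambda>x. x) \<in> measurable (K n) borel" for n
    by (auto simp: measurable_def K_sets K_space)
  have "M.indep_vars K zeta UNIV"
  proof (subst M.indep_vars_iff_distr_eq_PiM)
    show "distr M (PiM UNIV K) (\<lambda>x. \<lambda>i\<in>UNIV. zeta i x) = (\<Pi>\<^sub>M i\<in>UNIV. distr M (K i) (zeta i))"
      by (simp add: distr) (simp add: zeta_def M_def restrict_UNIV distr_id)
  qed (auto simp: zeta_K)
  from M.indep_vars_compose2[OF this, of "\<lambda>_ x. x" "\<lambda>_. borel"] id_K
  have indep: "M.indep_vars (\<lambda>_. borel) zeta UNIV" by simp
  have prob: "measure M {\<omega> \<in> space M. zeta n \<omega> = a} =
      measure (measure_pmf (bernoulli_pmf (\<theta> n))) {b. (if b then 1 else -1) = a}"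
    if "a \<in> {-1, 1}" for n a
  proof -
    have "measure M {\<omega> \<in> space M. zeta n \<omega> = a} = measure (distr M (K n) (zeta n)) {a}"
      by (subst measure_distr[OF zeta_K])
        (use that in \<open>auto simp: K_sets intro!: arg_cong[where f = "measure M"]\<close>)
    also have "\<dots> = measure (measure_pmf (bernoulli_pmf (\<theta> n))) {b. (if b then 1 else -1) = a}"
      unfolding distr unfolding K_def
      by (subst measure_distr[OF K_meas])
        (use that in \<open>auto intro!: arg_cong[where f = "measure (measure_pmf (bernoulli_pmf (\<theta> n)))"]\<close>)
    finally show ?thesis .
  qed
  have "{b. (if b then 1 else -1) = (1::real)} = {True}"
    "{b. (if b then 1 else -1) = (-1::real)} = {False}" by auto
  then have pos: "measure M {\<omega> \<in> space M. zeta n \<omega> = 1} = \<theta> n"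
    and neg: "measure M {\<omega> \<in> space M. zeta n \<omega> = -1} = 1 - \<theta> n" for n
    using prob[of 1 n] prob[of "-1" n] \<theta>[of n] by (simp_all add: measure_pmf_single)
  have "bernoulli_space M \<theta>"
    by unfold_locales (fact \<theta> space_M sets_M indep pos neg)+
  then show ?thesis by blast
qed

definition Gamma :: "nat set set" where
  "Gamma = {\<sigma>. finite \<sigma>}"

text \<open>The Walsh functions. They are used for the symmetric case only, where \<open>Z_n = \<zeta>_n\<close>;
  the empty product gives \<open>Z_\<emptyset> = 1\<close>.\<close>

definition Z :: "nat set \<Rightarrow> (nat \<Rightarrow> real) \<Rightarrow> complex" where
  "Z \<sigma> \<omega> = (\<Prod>i\<in>\<sigma>. complex_of_real (zeta i \<omega>))"

definition lam :: "nat set \<Rightarrow> real" where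
  "lam \<sigma> = (\<Prod>k\<in>\<sigma>. 1 + real k)"

section \<open>The space of square-integrable functions\<close>

text \<open>Elements of \<open>L\<^sup>2\<close> are represented by functions, and equality in \<open>L\<^sup>2\<close> is
  equality almost everywhere.\<close>

definition L2 :: "'a measure \<Rightarrow> ('a \<Rightarrow> complex) set" where
  "L2 M = {\<xi> \<in> borel_measurable M. integrable M (\<lambda>\<omega>. (cmod (\<xi> \<omega>))\<^sup>2)}"

definition L2_inner :: "'a measure \<Rightarrow> ('a \<Rightarrow> complex) \<Rightarrow> ('a \<Rightarrow> complex) \<Rightarrow> complex" where
  "L2_inner M \<xi> \<eta> = (LINT \<omega>|M. cnj (\<xi> \<omega>) * \<eta> \<omega>)"

definition L2_norm :: "'a measure \<Rightarrow> ('a \<Rightarrow> complex) \<Rightarrow> real" where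
  "L2_norm M \<xi> = sqrt (LINT \<omega>|M. (cmod (\<xi> \<omega>))\<^sup>2)"

definition bounded_operator ::
  "'a measure \<Rightarrow> (('a \<Rightarrow> complex) \<Rightarrow> ('a \<Rightarrow> complex)) \<Rightarrow> bool" where
  "bounded_operator M P \<longleftrightarrow>
    (\<forall>\<xi>\<in>L2 M. P \<xi> \<in> L2 M) \<and>
    (\<forall>\<xi>\<in>L2 M. \<forall>\<eta>\<in>L2 M. (AE \<omega> in M. \<xi> \<omega> = \<eta> \<omega>) \<longrightarrow> (AE \<omega> in M. P \<xi> \<omega> = P \<eta> \<omega>)) \<and>
    (\<forall>\<xi>\<in>L2 M. \<forall>\<eta>\<in>L2 M. \<forall>a b.
      AE \<omega> in M. P (\<lambda>x. a * \<xi> x + b * \<eta> x) \<omega> = a * P \<xi> \<omega> + b * P \<eta> \<omega>) \<and>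
    (\<exists>C. \<forall>\<xi>\<in>L2 M. L2_norm M (P \<xi>) \<le> C * L2_norm M \<xi>)"

definition orthogonal_projection ::
  "'a measure \<Rightarrow> (('a \<Rightarrow> complex) \<Rightarrow> ('a \<Rightarrow> complex)) \<Rightarrow> bool" where
  "orthogonal_projection M P \<longleftrightarrow>
    bounded_operator M P \<and>
    (\<forall>\<xi>\<in>L2 M. AE \<omega> in M. P (P \<xi>) \<omega> = P \<xi> \<omega>) \<and>
    (\<forall>\<xi>\<in>L2 M. \<forall>\<eta>\<in>L2 M. L2_inner M (P \<xi>) \<eta> = L2_inner M \<xi> (P \<eta>))"

section \<open>Test functionals and generalized functionals\<close>

definition S_p :: "(nat \<Rightarrow> real) measure \<Rightarrow> real \<Rightarrow> ((nat \<Rightarrow> real) \<Rightarrow> complex) set" where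
  "S_p M p = {\<xi> \<in> L2 M.
    (\<lambda>\<sigma>. lam \<sigma> powr (2 * p) * (cmod (L2_inner M (Z \<sigma>) \<xi>))\<^sup>2) summable_on Gamma}"

definition S_norm :: "(nat \<Rightarrow> real) measure \<Rightarrow> real \<Rightarrow> ((nat \<Rightarrow> real) \<Rightarrow> complex) \<Rightarrow> real" where
  "S_norm M p \<xi> =
    sqrt (\<Sum>\<^sub>\<infinity>\<sigma>\<in>Gamma. lam \<sigma> powr (2 * p) * (cmod (L2_inner M (Z \<sigma>) \<xi>))\<^sup>2)"

definition S :: "(nat \<Rightarrow> real) measure \<Rightarrow> ((nat \<Rightarrow> real) \<Rightarrow> complex) set" where
  "S M = (\<Inter>p\<in>{0..}. S_p M p)"

definition S_topology :: "(nat \<Rightarrow> real) measure \<Rightarrow> ((nat \<Rightarrow> real) \<Rightarrow> complex) topology" where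
  "S_topology M = topology_generated_by
    {{\<eta> \<in> S M. S_norm M p (\<lambda>\<omega>. \<eta> \<omega> - \<xi> \<omega>) < r} |\<xi> p r. \<xi> \<in> S M \<and> 0 \<le> p \<and> 0 < r}"

text \<open>Members of the dual need not be required explicitly to agree on almost everywhere equal
  functions: such functions are at distance 0 in every norm, so they are topologically
  indistinguishable, and a continuous scalar function takes the same value on them.
  Values of \<open>\<Phi>\<close> outside \<open>S M\<close> are irrelevant.\<close>

definition S_dual :: "(nat \<Rightarrow> real) measure \<Rightarrow> (((nat \<Rightarrow> real) \<Rightarrow> complex) \<Rightarrow> complex) set" where
  "S_dual M = {\<Phi>.
    (\<forall>\<xi>\<in>S M. \<forall>\<eta>\<in>S M. \<forall>a b. \<Phi> (\<lambda>\<omega>. a * \<xi> \<omega> + b * \<eta> \<omega>) = a * \<Phi> \<xi> + b * \<Phi> \<eta>) \<and>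
    continuous_map (S_topology M) euclidean \<Phi>}"

section \<open>Spectral measures\<close>

definition spectral_measure ::
  "'a measure \<Rightarrow> ('a set \<Rightarrow> ('a \<Rightarrow> complex) \<Rightarrow> ('a \<Rightarrow> complex)) \<Rightarrow> bool" where
  "spectral_measure M \<pi> \<longleftrightarrow>
    (\<forall>E\<in>sets M. orthogonal_projection M (\<pi> E)) \<and>
    (\<forall>\<xi>\<in>L2 M. AE \<omega> in M. \<pi> (space M) \<xi> \<omega> = \<xi> \<omega>) \<and>
    (\<forall>E :: nat \<Rightarrow> 'a set. range E \<subseteq> sets M \<longrightarrow> disjoint_family E \<longrightarrow>
      (\<forall>\<xi>\<in>L2 M.
        (\<lambda>n. L2_norm M (\<lambda>\<omega>. (\<Sum>k<n. \<pi> (E k) \<xi> \<omega>) - \<pi> (\<Union>k. E k) \<xi> \<omega>)) \<longlonglongrightarrow> 0))"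

definition spectral_density ::
  "(nat \<Rightarrow> real) measure \<Rightarrow>
   ((nat \<Rightarrow> real) set \<Rightarrow> ((nat \<Rightarrow> real) \<Rightarrow> complex) \<Rightarrow> ((nat \<Rightarrow> real) \<Rightarrow> complex)) \<Rightarrow>
   nat set \<Rightarrow> nat set \<Rightarrow> ((nat \<Rightarrow> real) \<Rightarrow> complex) \<Rightarrow> bool" where
  "spectral_density M \<pi> \<sigma> \<tau> \<phi> \<longleftrightarrow>
    \<phi> \<in> S M \<and>
    (\<forall>E\<in>sets M. L2_inner M (\<pi> E (Z \<sigma>)) (Z \<tau>) = (LINT \<omega>:E|M. \<phi> \<omega>))"

definition S_smooth ::
  "(nat \<Rightarrow> real) measure \<Rightarrow>
   ((nat \<Rightarrow> real) set \<Rightarrow> ((nat \<Rightarrow> real) \<Rightarrow> complex) \<Rightarrow> ((nat \<Rightarrow> real) \<Rightarrow> complex)) \<Rightarrow> bool" where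
  "S_smooth M \<pi> \<longleftrightarrow>
    spectral_measure M \<pi> \<and> (\<forall>\<sigma>\<in>Gamma. \<forall>\<tau>\<in>Gamma. \<exists>\<phi>. spectral_density M \<pi> \<sigma> \<tau> \<phi>)"

text \<open>Spectral densities are unique up to almost everywhere equality, so the quantifier
  over \<open>\<phi>\<close> ranges over the representatives of a single element of \<open>S M\<close>. It cannot be
  vacuous, since smoothness of \<open>\<pi>\<close> is part of the definition.\<close>

definition integrable_wrt ::
  "(nat \<Rightarrow> real) measure \<Rightarrow>
   ((nat \<Rightarrow> real) set \<Rightarrow> ((nat \<Rightarrow> real) \<Rightarrow> complex) \<Rightarrow> ((nat \<Rightarrow> real) \<Rightarrow> complex)) \<Rightarrow>
   (((nat \<Rightarrow> real) \<Rightarrow> complex) \<Rightarrow> complex) \<Rightarrow> bool" where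
  "integrable_wrt M \<pi> \<Phi> \<longleftrightarrow>
    S_smooth M \<pi> \<and> \<Phi> \<in> S_dual M \<and>
    (\<exists>C\<ge>0. \<exists>p\<ge>0. \<forall>\<sigma>\<in>Gamma. \<forall>\<tau>\<in>Gamma. \<forall>\<phi>. spectral_density M \<pi> \<sigma> \<tau> \<phi> \<longrightarrow>
      cmod (\<Phi> \<phi>) \<le> C * lam \<sigma> powr p * lam \<tau> powr p)"

definition canonical_spectral_measure ::
  "'a set \<Rightarrow> ('a \<Rightarrow> complex) \<Rightarrow> ('a \<Rightarrow> complex)" where
  "canonical_spectral_measure E \<xi> = (\<lambda>\<omega>. indicator E \<omega> * \<xi> \<omega>)"

end

theory Submission
  imports Defs
begin

text \<open>Continuity of \<open>\<Phi>\<close> at \<open>0\<close> yields \<open>p\<close> and \<open>\<epsilon>\<close> such that \<open>cmod (\<Phi> (c Z\<^sub>\<rho>)) < 1\<close> as soon as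
  \<open>cmod c * \<lambda>\<^sub>\<rho>\<^sup>p < \<epsilon>\<close>, so \<open>cmod (\<Phi> Z\<^sub>\<rho>)\<close> is bounded by a multiple of \<open>\<lambda>\<^sub>\<rho>\<^sup>p\<close>. The densities of the
  canonical spectral measure are the \<open>Z\<^sub>\<rho>\<close> with \<open>\<rho>\<close> the symmetric difference of \<open>\<sigma>\<close> and \<open>\<tau>\<close>, and
  \<open>\<lambda>\<^sub>\<rho> \<le> \<lambda>\<^sub>\<sigma> \<lambda>\<^sub>\<tau>\<close> because all factors \<open>1 + k\<close> are at least \<open>1\<close>.\<close>

section \<open>Weights\<close>

lemma sym_diff_Gamma: "\<sigma> \<in> Gamma \<Longrightarrow> \<tau> \<in> Gamma \<Longrightarrow> sym_diff \<sigma> \<tau> \<in> Gamma"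
  by (simp add: Gamma_def)

lemma lam_ge_1: "1 \<le> lam \<sigma>"
  unfolding lam_def by (rule prod_ge_1) auto

lemma lam_sym_diff_le:
  assumes "finite \<sigma>" "finite \<tau>"
  shows "lam (sym_diff \<sigma> \<tau>) \<le> lam \<sigma> * lam \<tau>"
proof -
  have diff: "lam (A - B) \<le> lam A" if "finite A" for A B
    unfolding lam_def by (rule prod_mono2) (use that in auto)
  have "lam (sym_diff \<sigma> \<tau>) = lam (\<sigma> - \<tau>) * lam (\<tau> - \<sigma>)"
    unfolding lam_def by (rule prod.union_disjoint) (use assms in auto)
  also have "\<dots> \<le> lam \<sigma> * lam \<tau>"
    using diff[OF assms(1)] diff[OF assms(2)] lam_ge_1[of \<sigma>] lam_ge_1[of "\<tau> - \<sigma>"]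
    by (intro mult_mono) auto
  finally show ?thesis .
qed

section \<open>The canonical spectral measure\<close>

lemma indicator_mult_L2:
  assumes "E \<in> sets M" "\<xi> \<in> L2 M"
  shows "(\<lambda>\<omega>. indicator E \<omega> * \<xi> \<omega>) \<in> L2 M"
  unfolding L2_def
proof (intro CollectI conjI)
  have [measurable]: "E \<in> sets M" "\<xi> \<in> borel_measurable M" using assms by (auto simp: L2_def)
  show "(\<lambda>\<omega>. indicator E \<omega> * \<xi> \<omega>) \<in> borel_measurable M" by measurable
  show "integrable M (\<lambda>\<omega>. (cmod (indicator E \<omega> * \<xi> \<omega>))\<^sup>2)"
    by (rule Bochner_Integration.integrable_bound[of M "\<lambda>\<omega>. (cmod (\<xi> \<omega>))\<^sup>2"])
      (use assms in \<open>auto simp: L2_def indicator_def\<close>)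
qed

lemma L2_norm_indicator_le:
  assumes "E \<in> sets M" "\<xi> \<in> L2 M"
  shows "L2_norm M (\<lambda>\<omega>. indicator E \<omega> * \<xi> \<omega>) \<le> L2_norm M \<xi>"
  unfolding L2_norm_def
  by (intro real_sqrt_le_mono integral_mono)
    (use indicator_mult_L2[OF assms] assms in \<open>auto simp: L2_def indicator_def\<close>)

text \<open>Multiplication by a function with values 0 and 1 is idempotent because the function is
  its own square, symmetric because it is real, and a contraction by
  \<open>L2_norm_indicator_le\<close>.\<close>

lemma orthogonal_projection_canonical:
  assumes "E \<in> sets M"
  shows "orthogonal_projection M (canonical_spectral_measure E)"
proof -
  have "\<exists>C. \<forall>\<xi>\<in>L2 M. L2_norm M (\<lambda>\<omega>. indicator E \<omega> * \<xi> \<omega>) \<le> C * L2_norm M \<xi>"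
    using L2_norm_indicator_le[OF assms] by (intro exI[of _ 1]) auto
  then have "bounded_operator M (canonical_spectral_measure E)"
    unfolding bounded_operator_def canonical_spectral_measure_def
    using indicator_mult_L2[OF assms] by (auto simp: algebra_simps)
  moreover have "cnj (indicator E \<omega>) = (indicator E \<omega> :: complex)" for \<omega>
    by (simp add: indicator_def)
  ultimately show ?thesis
    unfolding orthogonal_projection_def
    by (auto simp: canonical_spectral_measure_def L2_inner_def mult_ac indicator_def)
qed

text \<open>Dominated convergence: the error of the partial sums, \<open>D n\<close>, tends to 0
  pointwise, and its squared modulus is bounded by that of \<open>\<xi>\<close>.\<close>

lemma canonical_countably_additive:
  fixes E :: "nat \<Rightarrow> 'a set"
  assumes E: "range E \<subseteq> sets M" "disjoint_family E" and \<xi>: "\<xi> \<in> L2 M"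
  shows "(\<lambda>n. L2_norm M (\<lambda>\<omega>. (\<Sum>k<n. canonical_spectral_measure (E k) \<xi> \<omega>)
            - canonical_spectral_measure (\<Union>k. E k) \<xi> \<omega>)) \<longlonglongrightarrow> 0"
proof -
  have [measurable]: "\<xi> \<in> borel_measurable M" "\<And>k. E k \<in> sets M"
    using assms by (auto simp: L2_def)
  define D where
    "D n \<omega> = (indicator (\<Union>k<n. E k) \<omega> - indicator (\<Union>k. E k) \<omega>) * \<xi> \<omega>" for n \<omega>
  have D: "(\<Sum>k<n. canonical_spectral_measure (E k) \<xi> \<omega>)
            - canonical_spectral_measure (\<Union>k. E k) \<xi> \<omega> = D n \<omega>" for n \<omega>
  proof -
    \<comment> \<open>Disjointness collapses the sum of indicators into the indicator of the partial
      union.\<close>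
    have "disjoint_family_on E {..<n}"
      using E(2) by (auto simp: disjoint_family_on_def)
    then have "(\<Sum>k<n. indicator (E k) \<omega>) = (indicator (\<Union>k<n. E k) \<omega> :: complex)"
      by (subst indicator_UN_disjoint) auto
    then show ?thesis
      by (simp only: canonical_spectral_measure_def D_def left_diff_distrib flip: sum_distrib_right)
  qed
  have lim: "(\<lambda>n. (cmod (D n \<omega>))\<^sup>2) \<longlonglongrightarrow> 0" for \<omega>
  proof -
    have "(\<lambda>n. indicator (\<Union>k<n. E k) \<omega> :: complex) \<longlonglongrightarrow> indicator (\<Union>k. E k) \<omega>"
      by (rule LIMSEQ_indicator_UN)
    then show ?thesis
      unfolding D_def by (auto intro!: tendsto_eq_intros)
  qed
  have bound: "(cmod (D n \<omega>))\<^sup>2 \<le> (cmod (\<xi> \<omega>))\<^sup>2" for n \<omega>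
    by (auto simp: D_def indicator_def)
  have "(\<lambda>n. LINT \<omega>|M. (cmod (D n \<omega>))\<^sup>2) \<longlonglongrightarrow> (LINT \<omega>|M. 0)"
  proof (rule integral_dominated_convergence)
    show "integrable M (\<lambda>\<omega>. (cmod (\<xi> \<omega>))\<^sup>2)" using \<xi> by (simp add: L2_def)
    show "(\<lambda>\<omega>. (cmod (D n \<omega>))\<^sup>2) \<in> borel_measurable M" for n
      unfolding D_def by measurable
  qed (use lim bound in auto)
  from tendsto_real_sqrt[OF this] show ?thesis
    unfolding L2_norm_def D by simp
qed

lemma spectral_measure_canonical: "spectral_measure M canonical_spectral_measure"
  unfolding spectral_measure_def
  using orthogonal_projection_canonical canonical_countably_additive
  by (auto simp: canonical_spectral_measure_def indicator_def)

section \<open>Walsh functions\<close>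

lemma cnj_Z [simp]: "cnj (Z \<sigma> \<omega>) = Z \<sigma> \<omega>"
  by (simp add: Z_def)

lemma zeta_mult_self: "\<omega> \<in> sign_seqs \<Longrightarrow> zeta n \<omega> * zeta n \<omega> = 1"
proof -
  assume "\<omega> \<in> sign_seqs"
  then have "\<omega> n = -1 \<or> \<omega> n = 1" by (auto simp: sign_seqs_def)
  then show ?thesis by (auto simp: zeta_def)
qed

lemma Z_mult_self:
  assumes "\<omega> \<in> sign_seqs"
  shows "Z \<sigma> \<omega> * Z \<sigma> \<omega> = 1"
proof -
  have "Z \<sigma> \<omega> * Z \<sigma> \<omega> = (\<Prod>i\<in>\<sigma>. complex_of_real (zeta i \<omega> * zeta i \<omega>))"
    unfolding Z_def by (simp add: prod.distrib)
  then show ?thesis by (simp add: zeta_mult_self[OF assms] del: of_real_mult)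
qed

lemma Z_cases:
  assumes "\<omega> \<in> sign_seqs"
  shows "Z \<sigma> \<omega> = 1 \<or> Z \<sigma> \<omega> = -1"
  using Z_mult_self[OF assms] by (simp add: square_eq_1_iff)

lemma cmod_Z: "\<omega> \<in> sign_seqs \<Longrightarrow> cmod (Z \<sigma> \<omega>) = 1"
  using Z_cases[of \<omega> \<sigma>] by auto

text \<open>Factors with index in both sets occur twice and square to 1; the other factors are those
  of the symmetric difference.\<close>

lemma Z_sym_diff:
  assumes "\<omega> \<in> sign_seqs" "finite \<sigma>" "finite \<tau>"
  shows "Z \<sigma> \<omega> * Z \<tau> \<omega> = Z (sym_diff \<sigma> \<tau>) \<omega>"
proof -
  have split: "Z A \<omega> = Z (A - B) \<omega> * Z (A \<inter> B) \<omega>" if "finite A" for A B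
    unfolding Z_def using that prod.Int_Diff[OF that, of _ B] by (simp add: mult.commute)
  have "Z \<sigma> \<omega> * Z \<tau> \<omega> =
      (Z (\<sigma> - \<tau>) \<omega> * Z (\<tau> - \<sigma>) \<omega>) * (Z (\<sigma> \<inter> \<tau>) \<omega> * Z (\<sigma> \<inter> \<tau>) \<omega>)"
    using split[OF assms(2), of \<tau>] split[OF assms(3), of \<sigma>] by (simp add: Int_commute mult_ac)
  also have "\<dots> = Z (\<sigma> - \<tau>) \<omega> * Z (\<tau> - \<sigma>) \<omega>"
    by (simp add: Z_mult_self[OF assms(1)])
  also have "\<dots> = Z (sym_diff \<sigma> \<tau>) \<omega>"
    unfolding Z_def by (rule prod.union_disjoint[symmetric]) (use assms in auto)
  finally show ?thesis .
qed

section \<open>Elements with a single Walsh coefficient\<close>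

text \<open>Models \<open>c * Z \<rho>\<close> through its Walsh coefficients rather than by
  pointwise or almost everywhere equality. The norms see only these coefficients, and every
  representative of a spectral density of the canonical measure can be treated on the same footing
  as the Walsh function itself.\<close>

definition single_coeff ::
  "(nat \<Rightarrow> real) measure \<Rightarrow> nat set \<Rightarrow> complex \<Rightarrow> ((nat \<Rightarrow> real) \<Rightarrow> complex) \<Rightarrow> bool" where
  "single_coeff M \<rho> c \<eta> \<longleftrightarrow>
    \<eta> \<in> L2 M \<and> (\<forall>\<sigma>\<in>Gamma. L2_inner M (Z \<sigma>) \<eta> = (if \<sigma> = \<rho> then c else 0))"

lemma single_coeff_scale:
  assumes "single_coeff M \<rho> c \<eta>"
  shows "single_coeff M \<rho> (a * c) (\<lambda>\<omega>. a * \<eta> \<omega>)"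
proof -
  have "L2_inner M (Z \<sigma>) (\<lambda>\<omega>. a * \<eta> \<omega>) = a * L2_inner M (Z \<sigma>) \<eta>" for \<sigma>
    unfolding L2_inner_def by (simp add: mult.left_commute)
  then show ?thesis
    using assms by (auto simp: single_coeff_def L2_def norm_mult power_mult_distrib)
qed

text \<open>The weighted series has at most one nonzero term, whatever \<open>p\<close> is. Summing
  over \<open>Gamma \<inter> {\<rho>}\<close> also covers an index \<open>\<rho>\<close> outside
  \<open>Gamma\<close>.\<close>

lemma single_coeff_in_S:
  assumes "single_coeff M \<rho> c \<eta>"
  shows "\<eta> \<in> S M"
proof -
  have "(\<lambda>\<sigma>. lam \<sigma> powr (2 * p) * (cmod (L2_inner M (Z \<sigma>) \<eta>))\<^sup>2) summable_on Gamma" for p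
  proof (rule summable_on_cong_neutral[THEN iffD1])
    show "(\<lambda>\<sigma>. lam \<sigma> powr (2 * p) * (cmod (L2_inner M (Z \<sigma>) \<eta>))\<^sup>2)
        summable_on (Gamma \<inter> {\<rho>})" by (rule summable_on_finite) auto
  qed (use assms in \<open>auto simp: single_coeff_def\<close>)
  then show ?thesis using assms by (auto simp: S_def S_p_def single_coeff_def)
qed

context bernoulli_space
begin

section \<open>Expectations and integrability on Bernoulli space\<close>

lemma measurable_zeta [measurable]: "zeta n \<in> borel_measurable M"
  using indep_zeta by (auto simp: indep_vars_def)

lemma measurable_Z [measurable]: "Z \<sigma> \<in> borel_measurable M"
  unfolding Z_def[abs_def] by measurable

lemma integrable_zeta: "integrable M (zeta n)"
proof (rule integrable_const_bound[of _ 1])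
  show "AE \<omega> in M. norm (zeta n \<omega>) \<le> 1"
  proof (rule AE_I2)
    fix \<omega> assume "\<omega> \<in> space M"
    then have "\<omega> n = -1 \<or> \<omega> n = 1" by (auto simp: space_M sign_seqs_def)
    then show "norm (zeta n \<omega>) \<le> 1" by (auto simp: zeta_def)
  qed
qed measurable

lemma integral_zeta: "(LINT \<omega>|M. zeta n \<omega>) = 2 * \<theta> n - 1"
proof -
  let ?A = "\<lambda>a. {\<omega> \<in> space M. zeta n \<omega> = a}"
  have "(LINT \<omega>|M. zeta n \<omega>) = (LINT \<omega>|M. indicator (?A 1) \<omega> - indicator (?A (-1)) \<omega>)"
  proof (rule Bochner_Integration.integral_cong[OF refl])
    fix \<omega> assume "\<omega> \<in> space M"
    moreover from this have "\<omega> n = -1 \<or> \<omega> n = 1" by (auto simp: space_M sign_seqs_def)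
    ultimately show "zeta n \<omega> = indicator (?A 1) \<omega> - indicator (?A (-1)) \<omega>"
      by (auto simp: zeta_def indicator_def)
  qed
  also have "\<dots> = prob (?A 1) - prob (?A (-1))"
    by (subst Bochner_Integration.integral_diff) (auto simp: emeasure_eq_measure)
  finally show ?thesis by (simp add: prob_zeta_pos prob_zeta_neg)
qed

text \<open>Independence turns the expectation of the product into the product of the means
  \<open>2 * \<theta> i - 1\<close>. The real identity is then transported to the complex
  numbers.\<close>

lemma integral_Z:
  assumes "finite \<sigma>"
  shows "(LINT \<omega>|M. Z \<sigma> \<omega>) = (\<Prod>i\<in>\<sigma>. of_real (2 * \<theta> i - 1))"
proof (cases "\<sigma> = {}")
  case True
  then show ?thesis by (simp add: Z_def prob_space)
next
  case False
  have "indep_vars (\<lambda>_. borel) zeta \<sigma>"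
    using indep_zeta by (rule indep_vars_subset) auto
  then have "(LINT \<omega>|M. (\<Prod>i\<in>\<sigma>. zeta i \<omega>)) = (\<Prod>i\<in>\<sigma>. LINT \<omega>|M. zeta i \<omega>)"
    by (intro indep_vars_lebesgue_integral assms integrable_zeta)
  then have "complex_of_real (LINT \<omega>|M. (\<Prod>i\<in>\<sigma>. zeta i \<omega>)) = of_real (\<Prod>i\<in>\<sigma>. 2 * \<theta> i - 1)"
    by (simp only: integral_zeta)
  moreover have "(LINT \<omega>|M. Z \<sigma> \<omega>) = complex_of_real (LINT \<omega>|M. (\<Prod>i\<in>\<sigma>. zeta i \<omega>))"
    unfolding Z_def by (simp flip: of_real_prod)
  ultimately show ?thesis by simp
qed

lemma Z_in_L2: "Z \<sigma> \<in> L2 M"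
proof -
  have "integrable M (\<lambda>\<omega>. (cmod (Z \<sigma> \<omega>))\<^sup>2)"
    by (rule integrable_const_bound[of _ 1]) (auto simp: space_M cmod_Z)
  then show ?thesis by (simp add: L2_def)
qed

text \<open>Constants are integrable on a probability space, and expanding the square of
  \<open>cmod (\<xi> \<omega>) - 1\<close> bounds the modulus by 1 plus its square.\<close>

lemma integrable_L2:
  assumes "\<xi> \<in> L2 M"
  shows "integrable M \<xi>"
proof (rule Bochner_Integration.integrable_bound[of M "\<lambda>\<omega>. 1 + (cmod (\<xi> \<omega>))\<^sup>2"])
  show "AE \<omega> in M. norm (\<xi> \<omega>) \<le> norm (1 + (cmod (\<xi> \<omega>))\<^sup>2)"
  proof (rule AE_I2)
    fix \<omega>
    have "0 \<le> (cmod (\<xi> \<omega>) - 1)\<^sup>2" by simp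
    then have "2 * cmod (\<xi> \<omega>) \<le> 1 + (cmod (\<xi> \<omega>))\<^sup>2" by (simp add: power2_diff)
    then show "norm (\<xi> \<omega>) \<le> norm (1 + (cmod (\<xi> \<omega>))\<^sup>2)"
      using norm_ge_zero[of "\<xi> \<omega>"] unfolding real_norm_def by linarith
  qed
qed (use assms in \<open>auto simp: L2_def\<close>)

lemma integrable_Z_mult:
  assumes "integrable M \<xi>"
  shows "integrable M (\<lambda>\<omega>. Z \<sigma> \<omega> * \<xi> \<omega>)"
proof (rule Bochner_Integration.integrable_bound[OF assms])
  show "(\<lambda>\<omega>. Z \<sigma> \<omega> * \<xi> \<omega>) \<in> borel_measurable M" using assms by measurable
  show "AE \<omega> in M. norm (Z \<sigma> \<omega> * \<xi> \<omega>) \<le> norm (\<xi> \<omega>)"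
    by (rule AE_I2) (simp add: space_M cmod_Z norm_mult)
qed

lemma L2_inner_Z_diff:
  assumes "\<xi> \<in> L2 M" "\<eta> \<in> L2 M"
  shows "L2_inner M (Z \<sigma>) (\<lambda>\<omega>. \<eta> \<omega> - \<xi> \<omega>) = L2_inner M (Z \<sigma>) \<eta> - L2_inner M (Z \<sigma>) \<xi>"
  unfolding L2_inner_def cnj_Z right_diff_distrib
  by (intro Bochner_Integration.integral_diff integrable_Z_mult integrable_L2 assms)

text \<open>The triangle inequality for \<open>S_norm\<close>, in the only case needed.\<close>

lemma S_norm_single_diff:
  assumes \<eta>: "single_coeff M \<rho> c \<eta>" and \<rho>: "\<rho> \<in> Gamma" and \<xi>: "\<xi> \<in> S M" and p: "0 \<le> p"
  shows "S_norm M p (\<lambda>\<omega>. \<eta> \<omega> - \<xi> \<omega>) \<le> S_norm M p \<xi> + lam \<rho> powr p * cmod c"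
proof -
  define a where "a \<sigma> = L2_inner M (Z \<sigma>) \<xi>" for \<sigma>
  define w where "w = lam \<rho> powr p"
  define f where "f \<sigma> = lam \<sigma> powr (2 * p) * (cmod (a \<sigma>))\<^sup>2" for \<sigma>
  define g where "g \<sigma> = lam \<sigma> powr (2 * p) * (cmod (L2_inner M (Z \<sigma>) (\<lambda>\<omega>. \<eta> \<omega> - \<xi> \<omega>)))\<^sup>2" for \<sigma>
  \<comment> \<open>\<open>T\<close> collects the terms away from \<open>\<rho>\<close>; it is
    common to both norms, so only the term at \<open>\<rho>\<close> has to be compared.\<close>
  define T where "T = infsum f (Gamma - {\<rho>})"
  define K where "K = S_norm M p \<xi>"
  have L2: "\<xi> \<in> L2 M" "\<eta> \<in> L2 M"
    using \<xi> \<eta> by (auto simp: S_def S_p_def single_coeff_def)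
  have w: "0 \<le> w" "lam \<rho> powr (2 * p) = w\<^sup>2"
    by (auto simp: w_def power2_eq_square simp flip: powr_add)
  have f_nonneg: "0 \<le> f \<sigma>" for \<sigma> by (simp add: f_def)
  have "f summable_on Gamma"
    using \<xi> p by (auto simp: S_def S_p_def f_def[abs_def] a_def)
  then have summ: "f summable_on (Gamma - {\<rho>})"
    by (rule summable_on_subset_banach) auto
  \<comment> \<open>Away from \<open>\<rho>\<close> the coefficient of \<open>\<eta>\<close>
    vanishes, and the modulus ignores the remaining sign.\<close>
  have gf: "g \<sigma> = f \<sigma>" if "\<sigma> \<in> Gamma - {\<rho>}" for \<sigma>
    using that \<eta> by (simp add: g_def f_def a_def L2_inner_Z_diff[OF L2] single_coeff_def)
  have ins: "Gamma = insert \<rho> (Gamma - {\<rho>})" using \<rho> by auto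
  have "infsum f Gamma = f \<rho> + T"
    unfolding T_def by (subst ins, subst infsum_insert[OF summ]) auto
  then have K2: "K\<^sup>2 = w\<^sup>2 * (cmod (a \<rho>))\<^sup>2 + T" and K0: "0 \<le> K"
    unfolding K_def S_norm_def using infsum_nonneg[of Gamma f] f_nonneg
    by (simp_all add: f_def[abs_def] a_def w)
  have T0: "0 \<le> T" unfolding T_def by (rule infsum_nonneg) (rule f_nonneg)
  have "g summable_on (Gamma - {\<rho>})"
    using summ by (rule summable_on_cong[THEN iffD1, rotated]) (simp add: gf)
  then have "infsum g Gamma = g \<rho> + infsum g (Gamma - {\<rho>})"
    by (subst ins, subst infsum_insert) auto
  also have "infsum g (Gamma - {\<rho>}) = T"
    unfolding T_def by (rule infsum_cong) (rule gf)
  also have "g \<rho> = w\<^sup>2 * (cmod (c - a \<rho>))\<^sup>2"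
    using \<eta> \<rho> by (simp add: g_def a_def w L2_inner_Z_diff[OF L2] single_coeff_def)
  also have "w\<^sup>2 * (cmod (c - a \<rho>))\<^sup>2 + T \<le> (K + w * cmod c)\<^sup>2"
  proof -
    \<comment> \<open>The left side squared is a single term of the series for \<open>K\<close>
      squared. This bound controls the mixed term when the square of
      \<open>w * cmod c + w * cmod (a \<rho>)\<close> is expanded.\<close>
    have "w * cmod (a \<rho>) \<le> K"
      by (rule power2_le_imp_le) (use K2 K0 T0 in \<open>auto simp: power_mult_distrib\<close>)
    then have "(w * cmod (a \<rho>)) * (w * cmod c) \<le> K * (w * cmod c)"
      using w by (intro mult_right_mono) auto
    moreover have "(w * cmod (c - a \<rho>))\<^sup>2 \<le> (w * cmod c + w * cmod (a \<rho>))\<^sup>2"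
      using w norm_triangle_ineq4[of c "a \<rho>"]
      by (intro power_mono) (auto simp flip: distrib_left intro: mult_left_mono)
    ultimately show ?thesis
      using K2 by (simp add: power2_sum power_mult_distrib mult_ac)
  qed
  finally have "sqrt (infsum g Gamma) \<le> K + w * cmod c"
    using K0 w by (intro real_le_lsqrt) auto
  then show ?thesis by (simp add: S_norm_def g_def[abs_def] K_def w_def)
qed

section \<open>Neighbourhoods of zero and bounds for dual elements\<close>

lemma S_norm_zero_diff: "S_norm M p (\<lambda>\<omega>. 0 - \<xi> \<omega>) = S_norm M p \<xi>"
  by (simp add: S_norm_def L2_inner_def)

text \<open>Induction over the generation of the topology. The generating balls may be centred
  anywhere, so the base case recentres at zero with the triangle inequality
  \<open>S_norm_single_diff\<close>; finite intersections are absorbed by enlarging \<open>p\<close>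
  and shrinking \<open>\<epsilon>\<close>.\<close>

lemma open_nhd_zero:
  assumes "openin (S_topology M) U" "(\<lambda>_. 0) \<in> U"
  shows "\<exists>p\<ge>0. \<exists>\<epsilon>>0. \<forall>\<rho>\<in>Gamma. \<forall>c \<eta>.
    single_coeff M \<rho> c \<eta> \<longrightarrow> lam \<rho> powr p * cmod c < \<epsilon> \<longrightarrow> \<eta> \<in> U"
  using assms unfolding S_topology_def openin_topology_generated_by_iff
proof (induction rule: generate_topology_on.induct)
  case Empty
  then show ?case by simp
next
  case (Int A B)
  then obtain p \<epsilon> q \<delta> where
    A: "0 \<le> p" "0 < \<epsilon>" "\<forall>\<rho>\<in>Gamma. \<forall>c \<eta>. single_coeff M \<rho> c \<eta> \<longrightarrow>
          lam \<rho> powr p * cmod c < \<epsilon> \<longrightarrow> \<eta> \<in> A" and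
    B: "0 \<le> q" "0 < \<delta>" "\<forall>\<rho>\<in>Gamma. \<forall>c \<eta>. single_coeff M \<rho> c \<eta> \<longrightarrow>
          lam \<rho> powr q * cmod c < \<delta> \<longrightarrow> \<eta> \<in> B"
    by blast
  \<comment> \<open>Since \<open>lam \<rho>\<close> is at least 1, its powers increase with the
    exponent, so smallness for \<open>max p q\<close> implies smallness for both exponents.\<close>
  have le: "lam \<rho> powr r * cmod c \<le> lam \<rho> powr max p q * cmod c"
    if "r \<le> max p q" for \<rho> c r
    using that lam_ge_1[of \<rho>] by (intro mult_right_mono powr_mono) auto
  have "\<eta> \<in> A \<inter> B" if "\<rho> \<in> Gamma" "single_coeff M \<rho> c \<eta>"
    "lam \<rho> powr max p q * cmod c < min \<epsilon> \<delta>" for \<rho> c \<eta>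
  proof -
    have "lam \<rho> powr p * cmod c < \<epsilon>" "lam \<rho> powr q * cmod c < \<delta>"
      using that(3) le[of p \<rho> c] le[of q \<rho> c] by auto
    then show ?thesis using A(3) B(3) that(1,2) by blast
  qed
  then show ?case
    using A B by (intro exI[of _ "max p q"] conjI exI[of _ "min \<epsilon> \<delta>"]) auto
next
  case (UN K)
  then obtain k where k: "k \<in> K" "(\<lambda>_. 0) \<in> k" by auto
  then have "k \<subseteq> \<Union>K" by auto
  with UN.IH[OF k] show ?case by (meson subsetD)
next
  case (Basis s)
  then obtain \<xi> p r where s: "s = {\<eta> \<in> S M. S_norm M p (\<lambda>\<omega>. \<eta> \<omega> - \<xi> \<omega>) < r}"
    and \<xi>: "\<xi> \<in> S M" and p: "0 \<le> p" and r: "0 < r" by auto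
  \<comment> \<open>Zero lies in the ball around \<open>\<xi>\<close>, so the leftover radius
    \<open>r - S_norm M p \<xi>\<close> is positive and serves as \<open>\<epsilon>\<close>.\<close>
  have "S_norm M p \<xi> < r"
    using Basis.prems by (simp add: s S_norm_zero_diff[simplified])
  moreover have "\<eta> \<in> s" if "\<rho> \<in> Gamma" "single_coeff M \<rho> c \<eta>"
    "lam \<rho> powr p * cmod c < r - S_norm M p \<xi>" for \<rho> c \<eta>
    using S_norm_single_diff[OF that(2,1) \<xi> p] single_coeff_in_S[OF that(2)] that(3)
    by (auto simp: s)
  ultimately show ?case
    using p by (intro exI[of _ p] conjI exI[of _ "r - S_norm M p \<xi>"]) auto
qed

text \<open>The carrier of the generated topology is the union of the generators: each lies in
  \<open>S M\<close>, and each point of \<open>S M\<close> lies in the unit ball around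
  itself.\<close>

lemma topspace_S_topology: "topspace (S_topology M) = S M"
proof -
  have "\<xi> \<in> topspace (S_topology M)" if "\<xi> \<in> S M" for \<xi>
  proof -
    have "\<xi> \<in> {\<eta> \<in> S M. S_norm M 0 (\<lambda>\<omega>. \<eta> \<omega> - \<xi> \<omega>) < 1}"
      using that by (simp add: S_norm_def L2_inner_def)
    then show ?thesis
      unfolding S_topology_def topology_generated_by_topspace
      by (rule UnionI[rotated]) (use that in \<open>force intro: exI[of _ "0::real"] exI[of _ "1::real"]\<close>)
  qed
  then show ?thesis
    unfolding S_topology_def topology_generated_by_topspace by blast
qed

lemma single_coeff_zero: "single_coeff M \<rho> 0 (\<lambda>_. 0)"
  by (auto simp: single_coeff_def L2_def L2_inner_def)

text \<open>By homogeneity, an element scaled into a neighbourhood of zero on which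
  \<open>\<Phi>\<close> has modulus below 1 yields a bound for \<open>\<Phi>\<close> at the element
  itself. The constants \<open>C\<close> and \<open>p\<close> depend only on that neighbourhood,
  hence are uniform in \<open>\<rho>\<close>.\<close>

lemma S_dual_single_bound:
  assumes \<Phi>: "\<Phi> \<in> S_dual M"
  shows "\<exists>C\<ge>0. \<exists>p\<ge>0. \<forall>\<rho>\<in>Gamma. \<forall>\<eta>. single_coeff M \<rho> 1 \<eta> \<longrightarrow> cmod (\<Phi> \<eta>) \<le> C * lam \<rho> powr p"
proof -
  have lin: "\<Phi> (\<lambda>\<omega>. a * \<xi> \<omega>) = a * \<Phi> \<xi>" if "\<xi> \<in> S M" for a \<xi>
  proof -
    have "\<Phi> (\<lambda>\<omega>. a * \<xi> \<omega> + 0 * \<xi> \<omega>) = a * \<Phi> \<xi> + 0 * \<Phi> \<xi>"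
      using \<Phi> that unfolding S_dual_def by blast
    then show ?thesis by simp
  qed
  have zero: "(\<lambda>_. 0) \<in> S M" by (rule single_coeff_in_S[OF single_coeff_zero])
  define U where "U = {\<xi> \<in> S M. \<Phi> \<xi> \<in> ball 0 1}"
  have "openin (S_topology M) U"
    using \<Phi> openin_continuous_map_preimage[of "S_topology M" euclidean \<Phi> "ball 0 1"]
    by (simp add: S_dual_def U_def topspace_S_topology)
  moreover have "(\<lambda>_. 0) \<in> U"
    using lin[OF zero, of 0] zero by (simp add: U_def)
  ultimately have "\<exists>p\<ge>0. \<exists>\<epsilon>>0. \<forall>\<rho>\<in>Gamma. \<forall>c \<eta>.
      single_coeff M \<rho> c \<eta> \<longrightarrow> lam \<rho> powr p * cmod c < \<epsilon> \<longrightarrow> \<eta> \<in> U"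
    by (rule open_nhd_zero)
  then obtain p \<epsilon> where p: "0 \<le> p" and \<epsilon>: "0 < \<epsilon>"
    and U: "\<forall>\<rho>\<in>Gamma. \<forall>c \<eta>. single_coeff M \<rho> c \<eta> \<longrightarrow> lam \<rho> powr p * cmod c < \<epsilon> \<longrightarrow> \<eta> \<in> U"
    by blast
  have "cmod (\<Phi> \<eta>) \<le> 2 / \<epsilon> * lam \<rho> powr p" if \<rho>: "\<rho> \<in> Gamma" and \<eta>: "single_coeff M \<rho> 1 \<eta>" for \<rho> \<eta>
  proof -
    \<comment> \<open>Half of the critical scale \<open>\<epsilon> / lam \<rho> powr p\<close>, so
      that the strict inequality defining the neighbourhood holds; this produces the constant
      \<open>2 / \<epsilon>\<close>.\<close>
    define t where "t = \<epsilon> / (2 * lam \<rho> powr p)"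
    have lam_pos: "0 < lam \<rho> powr p" using lam_ge_1[of \<rho>] by simp
    then have t: "0 < t" "lam \<rho> powr p * t < \<epsilon>" using \<epsilon> by (auto simp: t_def)
    have "(\<lambda>\<omega>. of_real t * \<eta> \<omega>) \<in> U"
      by (rule U[rule_format, OF \<rho> single_coeff_scale[OF \<eta>]]) (use t in auto)
    then have "t * cmod (\<Phi> \<eta>) < 1"
      using t by (simp add: U_def lin[OF single_coeff_in_S[OF \<eta>]] norm_mult)
    then show ?thesis
      using t lam_pos \<epsilon> by (simp add: t_def field_simps)
  qed
  then show ?thesis using p \<epsilon> by (intro exI[of _ "2 / \<epsilon>"] conjI exI[of _ p]) auto
qed

text \<open>Since \<open>Z\<^sub>\<sigma>\<close> takes only the values \<open>1\<close> and \<open>-1\<close>, its inner product with \<open>\<phi>\<close> is a difference of two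
  set integrals of \<open>\<phi>\<close>; so no almost-everywhere uniqueness of densities is needed.\<close>

lemma L2_inner_Z_set_integrals:
  assumes "integrable M \<phi>"
  shows "L2_inner M (Z \<sigma>) \<phi> =
    (LINT \<omega>:{\<omega> \<in> space M. Z \<sigma> \<omega> = 1}|M. \<phi> \<omega>) - (LINT \<omega>:{\<omega> \<in> space M. Z \<sigma> \<omega> = -1}|M. \<phi> \<omega>)"
proof -
  let ?A = "\<lambda>a. {\<omega> \<in> space M. Z \<sigma> \<omega> = a}"
  have "L2_inner M (Z \<sigma>) \<phi> =
      (LINT \<omega>|M. indicator (?A 1) \<omega> *\<^sub>R \<phi> \<omega> - indicator (?A (-1)) \<omega> *\<^sub>R \<phi> \<omega>)"
    unfolding L2_inner_def
  proof (rule Bochner_Integration.integral_cong[OF refl])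
    fix \<omega> assume "\<omega> \<in> space M"
    then show "cnj (Z \<sigma> \<omega>) * \<phi> \<omega> = indicator (?A 1) \<omega> *\<^sub>R \<phi> \<omega> - indicator (?A (-1)) \<omega> *\<^sub>R \<phi> \<omega>"
      using Z_cases[of \<omega> \<sigma>] by (auto simp: space_M)
  qed
  also have "\<dots> = (LINT \<omega>:?A 1|M. \<phi> \<omega>) - (LINT \<omega>:?A (-1)|M. \<phi> \<omega>)"
    unfolding set_lebesgue_integral_def
    by (intro Bochner_Integration.integral_diff integrable_mult_indicator assms) measurable
  finally show ?thesis .
qed

end

section \<open>The symmetric case\<close>

locale symmetric_bernoulli_space = bernoulli_space +
  assumes theta_half: "\<theta> n = 1 / 2"
begin

text \<open>Orthonormality of the Walsh functions: the product of two of them is the one indexed by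
  the symmetric difference, whose expectation is a product of the means, all zero in the symmetric
  case.\<close>

lemma single_coeff_Z:
  assumes "\<rho> \<in> Gamma"
  shows "single_coeff M \<rho> 1 (Z \<rho>)"
  unfolding single_coeff_def
proof (intro conjI ballI)
  fix \<sigma> assume "\<sigma> \<in> Gamma"
  then have fin: "finite \<sigma>" "finite \<rho>" using assms by (auto simp: Gamma_def)
  have "L2_inner M (Z \<sigma>) (Z \<rho>) = (LINT \<omega>|M. Z (sym_diff \<sigma> \<rho>) \<omega>)"
    unfolding L2_inner_def cnj_Z
    by (rule Bochner_Integration.integral_cong) (auto simp: space_M Z_sym_diff fin)
  also have "\<dots> = (\<Prod>i\<in>sym_diff \<sigma> \<rho>. 0)"
    using fin by (subst integral_Z) (auto simp: theta_half)
  \<comment> \<open>The product of zeros is 1 exactly when the index set is empty, that is, when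
    \<open>\<sigma>\<close> and \<open>\<rho>\<close> coincide.\<close>
  also have "\<dots> = (if \<sigma> = \<rho> then 1 else 0)"
    using fin by (auto simp: card_gt_0_iff)
  finally show "L2_inner M (Z \<sigma>) (Z \<rho>) = (if \<sigma> = \<rho> then 1 else 0)" .
qed (rule Z_in_L2)

section \<open>Spectral densities of the canonical measure\<close>

lemma L2_inner_canonical:
  assumes "\<sigma> \<in> Gamma" "\<tau> \<in> Gamma"
  shows "L2_inner M (canonical_spectral_measure E (Z \<sigma>)) (Z \<tau>) =
    (LINT \<omega>:E|M. Z (sym_diff \<sigma> \<tau>) \<omega>)"
  unfolding L2_inner_def set_lebesgue_integral_def
proof (rule Bochner_Integration.integral_cong[OF refl])
  fix \<omega> assume "\<omega> \<in> space M"
  then have "Z \<sigma> \<omega> * Z \<tau> \<omega> = Z (sym_diff \<sigma> \<tau>) \<omega>"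
    using assms by (intro Z_sym_diff) (auto simp: Gamma_def space_M)
  then show "cnj (canonical_spectral_measure E (Z \<sigma>) \<omega>) * Z \<tau> \<omega> =
      indicator E \<omega> *\<^sub>R Z (sym_diff \<sigma> \<tau>) \<omega>"
    by (simp add: canonical_spectral_measure_def indicator_def)
qed

lemma S_smooth_canonical: "S_smooth M canonical_spectral_measure"
  unfolding S_smooth_def spectral_density_def
  using spectral_measure_canonical L2_inner_canonical
    single_coeff_in_S[OF single_coeff_Z[OF sym_diff_Gamma]]
  by blast

text \<open>Makes the bound on \<open>\<Phi>\<close> available for an arbitrary density
  \<open>\<phi>\<close>: its integral over each measurable set agrees with that of the Walsh
  function, and these integrals determine all Walsh coefficients.\<close>

lemma single_coeff_spectral_density:
  assumes "\<sigma> \<in> Gamma" "\<tau> \<in> Gamma"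
    and dens: "spectral_density M canonical_spectral_measure \<sigma> \<tau> \<phi>"
  shows "single_coeff M (sym_diff \<sigma> \<tau>) 1 \<phi>"
proof -
  let ?\<psi> = "Z (sym_diff \<sigma> \<tau>)"
  have L2: "\<phi> \<in> L2 M" using dens by (auto simp: spectral_density_def S_def S_p_def)
  have "(LINT \<omega>:E|M. \<phi> \<omega>) = (LINT \<omega>:E|M. ?\<psi> \<omega>)" if "E \<in> sets M" for E
    using dens that L2_inner_canonical[OF assms(1,2)] by (simp add: spectral_density_def)
  \<comment> \<open>The integrals are compared on the two level sets of
    \<open>Z \<upsilon>\<close>.\<close>
  then have "L2_inner M (Z \<upsilon>) \<phi> = L2_inner M (Z \<upsilon>) ?\<psi>" for \<upsilon>
    by (simp add: L2_inner_Z_set_integrals integrable_L2 L2 Z_in_L2)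
  then show ?thesis
    using single_coeff_Z[OF sym_diff_Gamma[OF assms(1,2)]] L2 by (simp add: single_coeff_def)
qed

lemma integrable_wrt_canonical:
  assumes \<Phi>: "\<Phi> \<in> S_dual M"
  shows "integrable_wrt M canonical_spectral_measure \<Phi>"
proof -
  obtain C p where C: "0 \<le> C" and p: "0 \<le> p"
    and bound: "\<forall>\<rho>\<in>Gamma. \<forall>\<eta>. single_coeff M \<rho> 1 \<eta> \<longrightarrow> cmod (\<Phi> \<eta>) \<le> C * lam \<rho> powr p"
    using S_dual_single_bound[OF \<Phi>] by blast
  have "cmod (\<Phi> \<phi>) \<le> C * lam \<sigma> powr p * lam \<tau> powr p"
    if st: "\<sigma> \<in> Gamma" "\<tau> \<in> Gamma"
      and dens: "spectral_density M canonical_spectral_measure \<sigma> \<tau> \<phi>" for \<sigma> \<tau> \<phi>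
  proof -
    have "cmod (\<Phi> \<phi>) \<le> C * lam (sym_diff \<sigma> \<tau>) powr p"
      by (intro bound[rule_format] sym_diff_Gamma single_coeff_spectral_density that)
    also have "\<dots> \<le> C * (lam \<sigma> * lam \<tau>) powr p"
      using C p st lam_sym_diff_le[of \<sigma> \<tau>] lam_ge_1[of "sym_diff \<sigma> \<tau>"]
      by (intro mult_left_mono powr_mono2) (auto simp: Gamma_def)
    also have "\<dots> = C * lam \<sigma> powr p * lam \<tau> powr p"
      using lam_ge_1[of \<sigma>] lam_ge_1[of \<tau>] by (simp add: powr_mult)
    finally show ?thesis .
  qed
  then show ?thesis
    using S_smooth_canonical \<Phi> C p unfolding integrable_wrt_def by blast
qed

end

theorem theorem5p2:
  fixes M :: "(nat \<Rightarrow> real) measure" and \<theta> :: "nat \<Rightarrow> real"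
    and \<Phi> :: "((nat \<Rightarrow> real) \<Rightarrow> complex) \<Rightarrow> complex"
  assumes "bernoulli_space M \<theta>"
    and "\<And>n. \<theta> n = 1 / 2"
    and "\<Phi> \<in> S_dual M"
  shows "integrable_wrt M canonical_spectral_measure \<Phi>"
proof -
  interpret symmetric_bernoulli_space M \<theta>
    by (intro symmetric_bernoulli_space.intro symmetric_bernoulli_space_axioms.intro assms(1,2))
  show ?thesis by (rule integrable_wrt_canonical[OF assms(3)])
qed

end
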